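(* For every $n\ge 0$, there is a bijection between the set of unordered binary increasing trees with $n+1$ nodes and the set of t-shelves of size $n$ in which no node that is a left child of its parent has a left child.
   Context: A treeshelf (t-shelf) of size $n\ge 1$ is a rooted binary tree with $n$ nodes labeled bijectively by $\{1,\dots,n\}$ so that labels strictly increase along every path starting at the root, in which every node has at most one left child and at most one right child, and every child (including a child with no sibling) is designated either as the left child or the right child of its parent. There is a unique empty t-shelf, of size $0$. An unordered binary increasing tree with $m$ nodes is a rooted tree with nodes labeled bijectively by $\{1,\dots,m\}$, labels strictly increasing along every path from the root, in which every node has at most two children and children are not ordered (no left/right distinction). *)

theory Defs
  imports Main "HOL-Library.Tree"
begin

definition increasing_tree :: "nat tree \<Rightarrow> bool" where
  "increasing_tree t \<longleftrightarrow>
     (\<forall>l a r. \<langle>l, a, r\<rangle> \<in> subtrees t \<longrightarrow> (\<forall>x \<in> set_tree l \<union> set_tree r. a < x))"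

text \<open>The constructor \<open>\<langle>\<rangle>\<close> marks an absent child, so it is not a node; \<open>size\<close> counts the nodes.\<close>

definition t_shelves :: "nat \<Rightarrow> nat tree set" where
  "t_shelves n =
     {t. size t = n \<and> distinct (inorder t) \<and> set_tree t = {1..n} \<and> increasing_tree t}"

definition no_left_left :: "'a tree \<Rightarrow> bool" where
  "no_left_left t \<longleftrightarrow>
     (\<forall>l a r. \<langle>l, a, r\<rangle> \<in> subtrees t \<longrightarrow> l \<noteq> \<langle>\<rangle> \<longrightarrow> left l = \<langle>\<rangle>)"

text \<open>
  Since labels are bijective, nodes are identified with their labels. A rooted tree is the set of
  its (parent, child) pairs, which carries no order on the children of a node.
\<close>

definition rooted_tree :: "'a set \<Rightarrow> ('a \<times> 'a) set \<Rightarrow> bool" where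
  "rooted_tree V E \<longleftrightarrow> E \<subseteq> V \<times> V \<and>
     (\<exists>r \<in> V. (\<forall>u. (u, r) \<notin> E) \<and>
              (\<forall>v \<in> V - {r}. \<exists>!u. (u, v) \<in> E) \<and>
              (\<forall>v \<in> V. (r, v) \<in> E\<^sup>*))"

definition unordered_binary_increasing_trees :: "nat \<Rightarrow> (nat \<times> nat) set set" where
  "unordered_binary_increasing_trees m =
     {E. rooted_tree {1..m} E \<and>
         (\<forall>(u, v) \<in> E. u < v) \<and>
         (\<forall>u \<in> {1..m}. card (E `` {u}) \<le> 2)}"

end

theory Submission
  imports Defs
begin

text \<open>
  The bijection is the first-child/next-sibling correspondence. Shift the labels of a t-shelf to
  \<open>{2..n+1}\<close>. The right child of a node \<open>a\<close> becomes the smallest child of \<open>a\<close> in the unordered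
  tree, a left child becomes the next sibling, and the root of the t-shelf becomes the smallest
  child of the extra node \<open>1\<close>. The t-shelf can be recovered from the edges: its root is the
  smallest vertex \<open>a\<close> other than \<open>1\<close>, the edges below \<open>a\<close> encode the right subtree, and all the
  others except \<open>(1, a)\<close> encode the left subtree. The children of a vertex form a left spine, so
  there are at most two of them everywhere iff no left child has a left child.
\<close>

subsection \<open>Binary trees with distinct increasing labels\<close>

definition distinct_heap :: "'a::linorder tree \<Rightarrow> bool" where
  "distinct_heap t \<longleftrightarrow> heap t \<and> distinct (inorder t)"

lemma distinct_heap_Leaf [simp]: "distinct_heap \<langle>\<rangle>"
  by (simp add: distinct_heap_def)

lemma distinct_heap_Node [simp]:
  "distinct_heap \<langle>l, a, r\<rangle> \<longleftrightarrow>
     (\<forall>x \<in> set_tree l. a < x) \<and> (\<forall>x \<in> set_tree r. a < x) \<and>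
     set_tree l \<inter> set_tree r = {} \<and> distinct_heap l \<and> distinct_heap r"
  by (auto simp: distinct_heap_def order_less_le)

lemma distinct_heap_map_tree:
  assumes "strict_mono_on (set_tree t) f"
  shows "distinct_heap (map_tree f t) \<longleftrightarrow> distinct_heap t"
  using assms
proof (induction t)
  case (Node l a r)
  have mono: "strict_mono_on (set_tree l) f" "strict_mono_on (set_tree r) f"
    using Node.prems by (auto intro: monotone_on_subset)
  have less: "f a < f x \<longleftrightarrow> a < x" if "x \<in> set_tree l \<union> set_tree r" for x
    using that by (intro strict_mono_on_less[OF Node.prems]) auto
  have "inj_on f (set_tree l \<union> set_tree r)"
    using Node.prems by (auto intro: strict_mono_on_imp_inj_on inj_on_subset)
  then have "f ` set_tree l \<inter> f ` set_tree r = {} \<longleftrightarrow> set_tree l \<inter> set_tree r = {}"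
    by (auto simp: inj_on_def)
  then show ?case using Node.IH mono less by (auto simp: tree.set_map)
qed simp

lemma bij_betw_map_tree_distinct_heaps:
  assumes "strict_mono_on S f"
  shows "bij_betw (map_tree f) {t. distinct_heap t \<and> set_tree t = S}
    {t. distinct_heap t \<and> set_tree t = f ` S}" (is "bij_betw _ ?A ?B")
proof (rule bij_betw_byWitness[where f' = "map_tree (inv_into S f)"])
  have inj: "inj_on f S" using assms by (rule strict_mono_on_imp_inj_on)
  show "\<forall>t \<in> ?A. map_tree (inv_into S f) (map_tree f t) = t"
    using inj by (auto simp: tree.map_comp intro!: tree.map_ident_strong)
  show right_inv: "\<forall>t \<in> ?B. map_tree f (map_tree (inv_into S f) t) = t"
    by (auto simp: tree.map_comp f_inv_into_f intro!: tree.map_ident_strong)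
  show "map_tree f ` ?A \<subseteq> ?B"
    using assms by (auto simp: tree.set_map distinct_heap_map_tree)
  show "map_tree (inv_into S f) ` ?B \<subseteq> ?A"
  proof (rule image_subsetI)
    fix t assume t: "t \<in> ?B"
    let ?s = "map_tree (inv_into S f) t"
    have "set_tree ?s = S"
      using t inj by (simp add: tree.set_map)
    then show "?s \<in> ?A"
      using right_inv t assms distinct_heap_map_tree[of ?s f] by simp
  qed
qed

lemma increasing_tree_Node:
  "increasing_tree \<langle>l, a, r\<rangle> \<longleftrightarrow>
     (\<forall>x \<in> set_tree l \<union> set_tree r. a < x) \<and> increasing_tree l \<and> increasing_tree r"
  by (simp add: increasing_tree_def imp_disjL all_conj_distrib)

lemma distinct_heap_iff_increasing_tree:
  "distinct_heap t \<longleftrightarrow> distinct (inorder t) \<and> increasing_tree t"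
proof (induction t)
  case Leaf
  show ?case by (simp add: increasing_tree_def)
qed (auto simp: increasing_tree_Node)

lemma t_shelves_eq_distinct_heaps: "t_shelves n = {t. distinct_heap t \<and> set_tree t = {1..n}}"
proof -
  have "size t = n" if "distinct (inorder t)" "set_tree t = {1..n}" for t
    using that distinct_card[of "inorder t"] by simp
  then show ?thesis by (auto simp: t_shelves_def distinct_heap_iff_increasing_tree)
qed

subsection \<open>Left spines\<close>

fun left_spine :: "'a tree \<Rightarrow> 'a list" where
  "left_spine \<langle>\<rangle> = []"
| "left_spine \<langle>l, a, r\<rangle> = a # left_spine l"

lemma set_left_spine_subset: "set (left_spine t) \<subseteq> set_tree t"
  by (induction t) auto

lemma distinct_left_spine: "distinct (inorder t) \<Longrightarrow> distinct (left_spine t)"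
  using set_left_spine_subset by (induction t) fastforce+

lemma no_left_left_Leaf [simp]: "no_left_left \<langle>\<rangle>"
  by (simp add: no_left_left_def)

lemma no_left_left_Node [simp]:
  "no_left_left \<langle>l, a, r\<rangle> \<longleftrightarrow>
     (l \<noteq> \<langle>\<rangle> \<longrightarrow> left l = \<langle>\<rangle>) \<and> no_left_left l \<and> no_left_left r"
  by (simp add: no_left_left_def imp_disjL all_conj_distrib)

lemma no_left_left_map_tree [simp]: "no_left_left (map_tree f t) \<longleftrightarrow> no_left_left t"
proof (induction t)
  case (Node l a r)
  then show ?case by (cases l) (auto simp: tree.map_sel)
qed simp

lemma length_left_spine_le_1_iff: "length (left_spine t) \<le> 1 \<longleftrightarrow> (t \<noteq> \<langle>\<rangle> \<longrightarrow> left t = \<langle>\<rangle>)"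
  by (cases t; cases "left t") auto

lemma no_left_left_iff_length_left_spine:
  "no_left_left t \<longleftrightarrow>
     length (left_spine t) \<le> 2 \<and> (\<forall>s \<in> subtrees t. length (left_spine (right s)) \<le> 2)"
proof (induction t)
  case (Node l a r)
  have "no_left_left \<langle>l, a, r\<rangle> \<longleftrightarrow>
      length (left_spine l) \<le> 1 \<and> no_left_left l \<and> no_left_left r"
    by (simp only: no_left_left_Node length_left_spine_le_1_iff)
  then show ?case unfolding Node.IH by (simp add: ball_Un) auto
qed simp

subsection \<open>Recursive trees as edge relations\<close>

text \<open>
  In an increasing tree every vertex other than the root is the target of an edge, so the vertex
  set is determined by the root and the edges: it is \<open>insert p (Range E)\<close>.
\<close>

definition recursive_tree :: "'a::order \<Rightarrow> ('a \<times> 'a) set \<Rightarrow> bool" where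
  "recursive_tree p E \<longleftrightarrow>
     Domain E \<subseteq> insert p (Range E) \<and> single_valued (E\<inverse>) \<and> (\<forall>(u, v) \<in> E. u < v)"

lemma recursive_tree_empty [simp]: "recursive_tree p {}"
  by (simp add: recursive_tree_def)

lemma recursive_tree_less: "recursive_tree p E \<Longrightarrow> (u, v) \<in> E \<Longrightarrow> u < v"
  by (auto simp: recursive_tree_def)

lemma recursive_tree_parent_unique:
  "recursive_tree p E \<Longrightarrow> (u, v) \<in> E \<Longrightarrow> (w, v) \<in> E \<Longrightarrow> u = w"
  by (auto simp: recursive_tree_def dest: single_valuedD)

lemma recursive_tree_source_cases:
  assumes "recursive_tree p E" "(u, v) \<in> E"
  obtains "u = p" | w where "(w, u) \<in> E"
  using assms by (auto simp: recursive_tree_def)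

lemma recursive_tree_imp_acyclic:
  assumes "recursive_tree p E"
  shows "acyclic E"
proof -
  have "acyclic (E\<inverse>)"
    by (rule acyclicI_order[where f = id]) (use assms in \<open>auto dest: recursive_tree_less\<close>)
  then show ?thesis by simp
qed

lemma recursive_tree_no_back_edge:
  assumes "recursive_tree p E" "(a, u) \<in> E\<^sup>*"
  shows "(u, a) \<notin> E"
  using recursive_tree_imp_acyclic[OF assms(1)] rtrancl_into_trancl1[OF assms(2), of a]
  by (auto simp: acyclic_def)

lemma recursive_tree_root_reaches:
  assumes "recursive_tree p E" "finite E" "v \<in> insert p (Range E)"
  shows "(p, v) \<in> E\<^sup>*"
proof -
  have "wf E" using assms(1,2) by (intro finite_acyclic_wf recursive_tree_imp_acyclic)
  then show ?thesis using assms(3)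
  proof (induction v rule: wf_induct_rule)
    case (less v)
    show ?case
    proof (cases "v = p")
      case False
      then obtain u where u: "(u, v) \<in> E" using less.prems by auto
      then have "u \<in> insert p (Range E)" using assms(1) by (auto simp: recursive_tree_def)
      then show ?thesis using less.IH u by (blast intro: rtrancl_into_rtrancl)
    qed simp
  qed
qed

lemma rooted_tree_increasing_iff_recursive_tree:
  assumes "finite S" "\<forall>v \<in> S. p < v"
  shows "rooted_tree (insert p S) E \<and> (\<forall>(u, v) \<in> E. u < v) \<longleftrightarrow> recursive_tree p E \<and> Range E = S"
    (is "?rooted \<and> ?incr \<longleftrightarrow> _")
proof
  assume "?rooted \<and> ?incr"
  then have ?rooted and incr: ?incr by blast+
  then obtain r where sub: "E \<subseteq> insert p S \<times> insert p S" and root: "\<forall>u. (u, r) \<notin> E"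
    and parent: "\<forall>v \<in> insert p S - {r}. \<exists>!u. (u, v) \<in> E"
    unfolding rooted_tree_def by blast
  have "(u, p) \<notin> E" for u using sub incr assms(2) by fastforce
  then have "r = p" using parent by blast
  have "p \<notin> S" using assms(2) by blast
  then have Range: "Range E = S" using sub root parent unfolding \<open>r = p\<close> by blast
  have "single_valued (E\<inverse>)"
    using parent sub root unfolding single_valued_def by blast
  then show "recursive_tree p E \<and> Range E = S"
    using sub incr Range unfolding recursive_tree_def by auto
next
  assume "recursive_tree p E \<and> Range E = S"
  then have tree: "recursive_tree p E" and S: "S = Range E" by blast+
  have sub: "E \<subseteq> insert p S \<times> S" using tree S by (auto simp: recursive_tree_def)
  then have "finite E" using assms(1) by (auto intro: finite_subset)
  then have "\<forall>v \<in> insert p S. (p, v) \<in> E\<^sup>*" using recursive_tree_root_reaches[OF tree] S by blast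
  moreover have "\<forall>u. (u, p) \<notin> E" using sub assms(2) by blast
  moreover have "\<forall>v \<in> insert p S - {p}. \<exists>!u. (u, v) \<in> E"
    using S by (auto intro: recursive_tree_parent_unique[OF tree])
  ultimately have ?rooted
    using sub unfolding rooted_tree_def by blast
  then show "?rooted \<and> ?incr" using tree by (simp add: recursive_tree_def)
qed

lemma recursive_tree_Min_child:
  fixes E :: "('a::linorder \<times> 'a) set"
  assumes "recursive_tree p E" "finite E" "E \<noteq> {}"
  shows "(p, Min (Range E)) \<in> E"
proof -
  have fin: "finite (Range E)" using assms(2) by (rule finite_Range)
  then have "Min (Range E) \<in> Range E" using assms(3) by (intro Min_in) auto
  then obtain u where u: "(u, Min (Range E)) \<in> E" by blast
  then have "u < Min (Range E)" using assms(1) by (simp add: recursive_tree_less)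
  then have "u \<notin> Range E" using fin by (auto dest: Min_le)
  then show ?thesis using u by (auto elim: recursive_tree_source_cases[OF assms(1)])
qed

subsection \<open>Cutting off the subtree of a vertex\<close>

definition edges_below :: "('a \<times> 'a) set \<Rightarrow> 'a \<Rightarrow> ('a \<times> 'a) set" where
  "edges_below E a = {(u, v) \<in> E. (a, u) \<in> E\<^sup>*}"

lemma edges_below_subset: "edges_below E a \<subseteq> E"
  by (auto simp: edges_below_def)

lemma recursive_tree_subset:
  assumes "recursive_tree p E" "F \<subseteq> E" "Domain F \<subseteq> insert q (Range F)"
  shows "recursive_tree q F"
  using assms single_valued_subset[of "F\<inverse>" "E\<inverse>"] by (auto simp: recursive_tree_def)

lemma recursive_tree_edges_below:
  assumes "recursive_tree p E"
  shows "recursive_tree a (edges_below E a)"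
proof (rule recursive_tree_subset[OF assms edges_below_subset])
  show "Domain (edges_below E a) \<subseteq> insert a (Range (edges_below E a))"
    by (auto simp: edges_below_def elim: rtranclE)
qed

lemma recursive_tree_remove_edges_below:
  assumes "recursive_tree p E"
  shows "recursive_tree p (E - insert (p, a) (edges_below E a))" (is "recursive_tree p ?F")
proof (rule recursive_tree_subset[OF assms])
  show "Domain ?F \<subseteq> insert p (Range ?F)"
  proof
    fix u assume "u \<in> Domain ?F"
    then obtain v where "(u, v) \<in> E" and not_below: "(a, u) \<notin> E\<^sup>*"
      by (auto simp: edges_below_def)
    from assms \<open>(u, v) \<in> E\<close> show "u \<in> insert p (Range ?F)"
    proof (cases rule: recursive_tree_source_cases)
      case (2 w)
      then have "(w, u) \<in> ?F"
        using not_below by (auto simp: edges_below_def intro: rtrancl_into_rtrancl)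
      then show ?thesis by blast
    qed simp
  qed
qed blast

lemma recursive_tree_join:
  assumes "recursive_tree p F" "recursive_tree a B" "p < a"
    and "a \<notin> Range F" "a \<notin> Range B" "Range F \<inter> Range B = {}"
  shows "recursive_tree p (insert (p, a) (F \<union> B))"
proof -
  let ?E = "insert (p, a) (F \<union> B)"
  have "Domain ?E \<subseteq> insert p (Range ?E)" "\<forall>(u, v) \<in> ?E. u < v"
    using assms(1-3) by (auto simp: recursive_tree_def)
  moreover have "single_valued (?E\<inverse>)"
  proof (rule single_valuedI)
    fix v u w assume "(v, u) \<in> ?E\<inverse>" "(v, w) \<in> ?E\<inverse>"
    then show "u = w"
      using assms(4-6) recursive_tree_parent_unique[OF assms(1)]
        recursive_tree_parent_unique[OF assms(2)] by blast
  qed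
  ultimately show ?thesis by (simp add: recursive_tree_def)
qed

lemma recursive_tree_cut:
  assumes "recursive_tree p E" "(p, a) \<in> E"
  obtains F B where "E = insert (p, a) (F \<union> B)" "recursive_tree p F" "recursive_tree a B"
    "a \<notin> Range F" "a \<notin> Range B" "Range F \<inter> Range B = {}"
proof
  let ?B = "edges_below E a" and ?F = "E - insert (p, a) (edges_below E a)"
  note parent_unique = recursive_tree_parent_unique[OF assms(1)]
  show "E = insert (p, a) (?F \<union> ?B)" using assms(2) edges_below_subset[of E a] by auto
  show "recursive_tree p ?F" using assms(1) by (rule recursive_tree_remove_edges_below)
  show "recursive_tree a ?B" using assms(1) by (rule recursive_tree_edges_below)
  show "a \<notin> Range ?F" using parent_unique assms(2) by blast
  show "a \<notin> Range ?B"
    using recursive_tree_no_back_edge[OF assms(1)] by (auto simp: edges_below_def)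
  show "Range ?F \<inter> Range ?B = {}" using parent_unique edges_below_subset[of E a] by blast
qed

lemma edges_below_join:
  assumes "recursive_tree a B" "finite B" "Domain F \<inter> insert a (Range B) = {}"
    and "p \<notin> insert a (Range B)"
  shows "edges_below (insert (p, a) (F \<union> B)) a = B"
proof -
  let ?E = "insert (p, a) (F \<union> B)"
  have sources: "Domain B \<subseteq> insert a (Range B)"
    using assms(1) by (simp add: recursive_tree_def)
  have "?E `` insert a (Range B) \<subseteq> insert a (Range B)"
    using assms(3,4) by blast
  then have "?E\<^sup>* `` insert a (Range B) = insert a (Range B)"
    by (rule Image_closed_trancl)
  moreover have "(a, u) \<in> ?E\<^sup>*" if "u \<in> insert a (Range B)" for u
    using recursive_tree_root_reaches[OF assms(1,2) that] rtrancl_mono[of B ?E] by blast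
  ultimately have "(a, u) \<in> ?E\<^sup>* \<longleftrightarrow> u \<in> insert a (Range B)" for u by blast
  then have "edges_below ?E a = {(u, v) \<in> ?E. u \<in> insert a (Range B)}"
    by (simp add: edges_below_def)
  also have "\<dots> = B" using sources assms(3,4) by auto
  finally show ?thesis .
qed

subsection \<open>The first-child/next-sibling correspondence\<close>

fun forest_edges :: "'a \<Rightarrow> 'a tree \<Rightarrow> ('a \<times> 'a) set" where
  "forest_edges p \<langle>\<rangle> = {}"
| "forest_edges p \<langle>l, a, r\<rangle> = insert (p, a) (forest_edges p l \<union> forest_edges a r)"

lemma finite_forest_edges [simp]: "finite (forest_edges p t)"
  by (induction t arbitrary: p) simp_all

lemma Range_forest_edges [simp]: "Range (forest_edges p t) = set_tree t"
  by (induction t arbitrary: p) (simp_all add: Range_Un_eq)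

lemma Domain_forest_edges: "Domain (forest_edges p t) \<subseteq> insert p (set_tree t)"
proof (induction t arbitrary: p)
  case (Node l a r)
  show ?case using Node.IH(1)[of p] Node.IH(2)[of a] by (simp add: Domain_Un_eq) blast
qed simp

lemma recursive_tree_forest_edges:
  assumes "distinct_heap t" "\<forall>x \<in> set_tree t. p < x"
  shows "recursive_tree p (forest_edges p t)"
  using assms
proof (induction t arbitrary: p)
  case (Node l a r)
  then have "a \<notin> set_tree l" "a \<notin> set_tree r" by auto
  with Node show ?case by (simp add: recursive_tree_join)
qed simp

lemma edges_below_forest_edges:
  assumes "distinct_heap \<langle>l, a, r\<rangle>" "p \<notin> set_tree \<langle>l, a, r\<rangle>"
  shows "edges_below (forest_edges p \<langle>l, a, r\<rangle>) a = forest_edges a r"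
proof -
  have "Domain (forest_edges p l) \<inter> insert a (set_tree r) = {}"
    using assms Domain_forest_edges[of p l] by auto
  moreover have "recursive_tree a (forest_edges a r)"
    using assms(1) by (intro recursive_tree_forest_edges) auto
  ultimately show ?thesis using assms(2) by (simp add: edges_below_join)
qed

lemma remove_edges_below_forest_edges:
  assumes "distinct_heap \<langle>l, a, r\<rangle>" "p \<notin> set_tree \<langle>l, a, r\<rangle>"
  shows "forest_edges p \<langle>l, a, r\<rangle> - insert (p, a) (edges_below (forest_edges p \<langle>l, a, r\<rangle>) a)
    = forest_edges p l"
proof -
  have target: "v \<in> set_tree t" if "(u, v) \<in> forest_edges q t" for u v q t
    using that by (metis Range.intros Range_forest_edges)
  have "(p, a) \<notin> forest_edges p l" "forest_edges p l \<inter> forest_edges a r = {}"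
    using assms(1) by (auto dest!: target)
  then show ?thesis
    unfolding edges_below_forest_edges[OF assms] by auto
qed

lemma Min_distinct_heap: "distinct_heap \<langle>l, a, r\<rangle> \<Longrightarrow> Min (set_tree \<langle>l, a, r\<rangle>) = a"
  by (intro Min_eqI) auto

lemma forest_edges_inject:
  assumes "forest_edges p t = forest_edges p t'"
    and "distinct_heap t" "p \<notin> set_tree t" "distinct_heap t'" "p \<notin> set_tree t'"
  shows "t = t'"
  using assms
proof (induction t arbitrary: p t')
  case Leaf
  then show ?case by (cases t') auto
next
  case (Node l a r)
  obtain l' b r' where t': "t' = \<langle>l', b, r'\<rangle>"
    using Node.prems(1) by (cases t') auto
  note heap = Node.prems(2,3) and heap' = Node.prems(4,5)[unfolded t']
  have edges: "forest_edges p \<langle>l, a, r\<rangle> = forest_edges p \<langle>l', b, r'\<rangle>"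
    using Node.prems(1) t' by simp
  then have "set_tree \<langle>l, a, r\<rangle> = set_tree \<langle>l', b, r'\<rangle>"
    by (metis Range_forest_edges)
  then have root: "b = a"
    using Min_distinct_heap heap(1) heap'(1) by metis
  have "forest_edges a r = forest_edges a r'"
    using edges_below_forest_edges heap heap' edges unfolding root by metis
  moreover have "a \<notin> set_tree r" "a \<notin> set_tree r'" using heap(1) heap'(1) root by auto
  ultimately have "r = r'" using Node.IH(2) heap(1) heap'(1) by simp
  moreover have "forest_edges p l = forest_edges p l'"
    using remove_edges_below_forest_edges heap heap' edges unfolding root by metis
  then have "l = l'" using Node.IH(1) heap heap' by auto
  ultimately show ?case by (simp add: t' root)
qed

lemma recursive_tree_imp_forest_edges:
  fixes E :: "('a::linorder \<times> 'a) set"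
  assumes "finite E" "recursive_tree p E"
  shows "\<exists>t. distinct_heap t \<and> forest_edges p t = E"
  using assms
proof (induction E arbitrary: p rule: finite_psubset_induct)
  case (psubset E)
  show ?case
  proof (cases "E = {}")
    case True
    then show ?thesis by (intro exI[of _ "\<langle>\<rangle>"]) simp
  next
    case False
    let ?a = "Min (Range E)"
    have "(p, ?a) \<in> E"
      using psubset.prems psubset.hyps False by (rule recursive_tree_Min_child)
    with psubset.prems obtain F B
      where E: "E = insert (p, ?a) (F \<union> B)" and F: "recursive_tree p F" "?a \<notin> Range F"
        and B: "recursive_tree ?a B" "?a \<notin> Range B" and disjoint: "Range F \<inter> Range B = {}"
      by (rule recursive_tree_cut)
    have "F \<subset> E" "B \<subset> E" using E F(2) B(2) by blast+
    then obtain l r where l: "distinct_heap l" "forest_edges p l = F"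
      and r: "distinct_heap r" "forest_edges ?a r = B"
      using psubset.IH F(1) B(1) by meson
    have sets: "set_tree l = Range F" "set_tree r = Range B"
      using l(2) r(2) Range_forest_edges by metis+
    have "?a < x" if "x \<in> Range F \<union> Range B" for x
    proof -
      have "x \<in> Range E" using that \<open>F \<subset> E\<close> \<open>B \<subset> E\<close> by blast
      then have "?a \<le> x" using finite_Range[OF psubset.hyps] by simp
      moreover have "x \<noteq> ?a" using that F(2) B(2) by blast
      ultimately show ?thesis by simp
    qed
    then have "distinct_heap \<langle>l, ?a, r\<rangle>" using l(1) r(1) sets disjoint by simp
    moreover have "forest_edges p \<langle>l, ?a, r\<rangle> = E" using l(2) r(2) E by simp
    ultimately show ?thesis by blast
  qed
qed

lemma bij_betw_forest_edges:
  assumes "finite S" "\<forall>x \<in> S. p < x"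
  shows "bij_betw (forest_edges p) {t. distinct_heap t \<and> set_tree t = S}
    {E. recursive_tree p E \<and> Range E = S}" (is "bij_betw _ ?T ?R")
proof (rule bij_betw_imageI)
  show "inj_on (forest_edges p) ?T"
    using assms(2) by (auto intro!: inj_onI forest_edges_inject)
  show "forest_edges p ` ?T = ?R"
  proof
    show "forest_edges p ` ?T \<subseteq> ?R"
      using assms(2) by (intro image_subsetI) (simp add: recursive_tree_forest_edges)
    show "?R \<subseteq> forest_edges p ` ?T"
    proof
      fix E assume E: "E \<in> ?R"
      then have "E \<subseteq> insert p S \<times> S" by (auto simp: recursive_tree_def)
      then have "finite E" using assms(1) by (auto intro: finite_subset)
      then obtain t where "distinct_heap t" "forest_edges p t = E"
        using recursive_tree_imp_forest_edges E by blast
      then show "E \<in> forest_edges p ` ?T" using E by auto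
    qed
  qed
qed

subsection \<open>Numbers of children\<close>

lemma forest_edges_Image_root:
  "p \<notin> set_tree t \<Longrightarrow> forest_edges p t `` {p} = set (left_spine t)"
proof (induction t)
  case (Node l a r)
  then have "forest_edges a r `` {p} = {}" using Domain_forest_edges[of a r] by auto
  then show ?case using Node by auto
qed simp

lemma forest_edges_Image_Node:
  assumes "\<langle>l, a, r\<rangle> \<in> subtrees t" "distinct (inorder t)" "p \<notin> set_tree t"
  shows "forest_edges p t `` {a} = set (left_spine r)"
  using assms
proof (induction t arbitrary: p)
  case (Node l' b r')
  have sources: "a \<notin> set_tree l' \<Longrightarrow> forest_edges p l' `` {a} = {}"
    "a \<notin> insert b (set_tree r') \<Longrightarrow> forest_edges b r' `` {a} = {}"
    using Node.prems(1,3) Domain_forest_edges[of p l'] Domain_forest_edges[of b r']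
    by (auto dest: in_set_tree_if)
  consider "l' = l" "b = a" "r' = r" | "\<langle>l, a, r\<rangle> \<in> subtrees l'" | "\<langle>l, a, r\<rangle> \<in> subtrees r'"
    using Node.prems(1) by auto
  then show ?case
  proof cases
    case 1
    then show ?thesis using Node.prems sources forest_edges_Image_root[of a r] by auto
  next
    case 2
    then show ?thesis using Node.IH(1) Node.prems sources by (auto dest: in_set_tree_if)
  next
    case 3
    then show ?thesis using Node.IH(2) Node.prems sources by (auto dest: in_set_tree_if)
  qed
qed simp

lemma no_left_left_iff_card_children:
  assumes "distinct (inorder t)" "p \<notin> set_tree t"
  shows "no_left_left t \<longleftrightarrow>
    (\<forall>u \<in> insert p (set_tree t). card (forest_edges p t `` {u}) \<le> 2)"
proof -
  have root: "card (forest_edges p t `` {p}) = length (left_spine t)"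
    using assms by (simp add: forest_edges_Image_root distinct_card distinct_left_spine)
  have node: "card (forest_edges p t `` {a}) = length (left_spine r)"
    if "\<langle>l, a, r\<rangle> \<in> subtrees t" for l a r
  proof -
    have "distinct (inorder r)" using assms(1) that by (induction t) auto
    then show ?thesis
      using forest_edges_Image_Node[OF that assms] by (simp add: distinct_card distinct_left_spine)
  qed
  have "(\<forall>s \<in> subtrees t. length (left_spine (right s)) \<le> 2) \<longleftrightarrow>
      (\<forall>u \<in> set_tree t. card (forest_edges p t `` {u}) \<le> 2)"
  proof (intro iffI ballI)
    fix u assume short: "\<forall>s \<in> subtrees t. length (left_spine (right s)) \<le> 2" and "u \<in> set_tree t"
    then obtain l r where "\<langle>l, u, r\<rangle> \<in> subtrees t" using set_treeE by metis
    then show "card (forest_edges p t `` {u}) \<le> 2" using short node by fastforce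
  next
    fix s assume "\<forall>u \<in> set_tree t. card (forest_edges p t `` {u}) \<le> 2" "s \<in> subtrees t"
    then show "length (left_spine (right s)) \<le> 2"
      using node[symmetric] by (cases s) (auto dest: in_set_tree_if)
  qed
  then show ?thesis using root by (simp add: no_left_left_iff_length_left_spine)
qed

subsection \<open>Unordered binary increasing trees\<close>

lemma unordered_binary_increasing_trees_eq:
  "unordered_binary_increasing_trees (n + 1) =
     {E \<in> {E. recursive_tree 1 E \<and> Range E = Suc ` {1..n}}.
        \<forall>u \<in> {1..n + 1}. card (E `` {u}) \<le> 2}"
proof -
  have "{1..n + 1} = insert 1 (Suc ` {1..n})" by (auto simp: image_Suc_atLeastAtMost)
  then have "rooted_tree {1..n + 1} E \<and> (\<forall>(u, v) \<in> E. u < v) \<longleftrightarrow>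
      recursive_tree 1 E \<and> Range E = Suc ` {1..n}" for E
    using rooted_tree_increasing_iff_recursive_tree[of "Suc ` {1..n}" 1 E] by simp
  then show ?thesis unfolding unordered_binary_increasing_trees_def by (simp flip: conj_assoc)
qed

lemma bij_betw_t_shelves_recursive_trees:
  "bij_betw (forest_edges 1 \<circ> map_tree Suc) (t_shelves n)
    {E. recursive_tree 1 E \<and> Range E = Suc ` {1..n}}"
proof (rule bij_betw_trans)
  show "bij_betw (map_tree Suc) (t_shelves n) {t. distinct_heap t \<and> set_tree t = Suc ` {1..n}}"
    unfolding t_shelves_eq_distinct_heaps
    by (rule bij_betw_map_tree_distinct_heaps) (simp add: strict_mono_on_def)
  show "bij_betw (forest_edges 1) {t. distinct_heap t \<and> set_tree t = Suc ` {1..n}}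
      {E. recursive_tree 1 E \<and> Range E = Suc ` {1..n}}"
    by (rule bij_betw_forest_edges) auto
qed

theorem theorem12:
  fixes n :: nat
  shows "\<exists>f. bij_betw f (unordered_binary_increasing_trees (n + 1))
                        {t \<in> t_shelves n. no_left_left t}"
proof -
  let ?g = "forest_edges 1 \<circ> map_tree Suc"
  have "(\<forall>u \<in> {1..n + 1}. card (?g t `` {u}) \<le> 2) \<longleftrightarrow> no_left_left t" if "t \<in> t_shelves n" for t
  proof -
    have "distinct (inorder (map_tree Suc t))" "1 \<notin> set_tree (map_tree Suc t)"
      "insert 1 (set_tree (map_tree Suc t)) = {1..n + 1}"
      using that by (auto simp: t_shelves_def inorder_map distinct_map tree.set_map
        image_Suc_atLeastAtMost)
    then show ?thesis
      using no_left_left_iff_card_children[of "map_tree Suc t" 1] by simp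
  qed
  then have "bij_betw ?g {t \<in> t_shelves n. no_left_left t}
      (unordered_binary_increasing_trees (n + 1))"
    unfolding unordered_binary_increasing_trees_eq
    by (rule bij_betw_Collect[OF bij_betw_t_shelves_recursive_trees])
  then show ?thesis by (blast intro: bij_betw_inv_into)
qed

end
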